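(* Let $M$ be a matroid on a finite ground set $E$ with lattice of flats $\mathcal{L}(M)$. The $h$-polynomial of the augmented Bergman complex $\Delta_M$ of $M$ is given by \[ h(\Delta_M,x)=h(\mathrm{I}_M,x)+x\sum_{F\in\mathcal{L}(M)\setminus\{E\}}h(\mathrm{I}_{M|_F},x)\,h(\underline{\Delta}_{M/F},x), \] where, for a flat $F$, $M|_F$ is the restriction of $M$ to $F$ and $M/F$ is the contraction of $M$ by $F$; $\mathrm{I}_N$ denotes the independence complex of a matroid $N$ and $\underline{\Delta}_N$ denotes its Bergman complex.
   Context: $h$-polynomial. For a $(d-1)$-dimensional simplicial complex $\Delta$, $h(\Delta,x)=\sum_{F\in\Delta}x^{|F|}(1-x)^{d-|F|}$ (sum over all faces, including the empty face; the complex $\{\varnothing\}$ has dimension $-1$ and $h$-polynomial $1$). Independence complex. $\mathrm{I}_N$ is the simplicial complex whose faces are the independent sets of the matroid $N$; its dimension is $\mathrm{rk}(N)-1$. Bergman complex. For a matroid $N$ with lattice of flats $\mathcal{L}(N)$, having minimum $\widehat{0}$ and maximum $\widehat{1}$, the Bergman complex $\underline{\Delta}_N$ is the simplicial complex of all chains (including the empty chain) in the poset $\mathcal{L}(N)\setminus\{\widehat{0},\widehat{1}\}$. In particular $\underline{\Delta}_N=\{\varnothing\}$ if $N$ has rank zero or one. Augmented Bergman complex. Let $U=\{u_i : i\in E\}$ and $V_M=\{v_F : F\in\mathcal{L}(M)\setminus\{E\}\}$ be disjoint sets in one-to-one correspondence with $E$ and with the set of proper flats $\mathcal{L}(M)\setminus\{E\}$,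 respectively. The augmented Bergman complex $\Delta_M$ is the simplicial complex on $U\cup V_M$ whose faces are the sets $\{u_i: i\in S\}\cup\{v_{F_1},\dots,v_{F_k}\}$, where $S$ is an independent set of $M$, $F_1,\dots,F_k$ are proper flats, and either $k\ge1$ and $S\subseteq F_1\subset F_2\subset\cdots\subset F_k$ (strict inclusions between the $F_j$), or $k=0$ and $S$ is an arbitrary independent set. Its dimension is $\mathrm{rk}(M)-1$. *)

theory Defs
  imports "HOL-Computational_Algebra.Polynomial"
begin

section \<open>Simplicial complexes and their h-polynomials\<close>

definition simplicial_complex :: "'v set set \<Rightarrow> bool" where
  "simplicial_complex \<Delta> \<longleftrightarrow>
     finite \<Delta> \<and> {} \<in> \<Delta> \<and> (\<forall>F\<in>\<Delta>. finite F) \<and> (\<forall>F\<in>\<Delta>. \<forall>G. G \<subseteq> F \<longrightarrow> G \<in> \<Delta>)"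

text \<open>The dimension is an integer, so that \<open>{{}}\<close> gets dimension \<open>- 1\<close>.\<close>

definition complex_dim :: "'v set set \<Rightarrow> int" where
  "complex_dim \<Delta> = Max ((\<lambda>F. int (card F) - 1) ` \<Delta>)"

definition h_poly :: "'v set set \<Rightarrow> int poly" where
  "h_poly \<Delta> = (let d = nat (complex_dim \<Delta> + 1) in
     (\<Sum>F\<in>\<Delta>. [:0, 1:] ^ card F * (1 - [:0, 1:]) ^ (d - card F)))"


section \<open>Matroids\<close>

record 'a set_system =
  ground :: "'a set"
  indep_sets :: "'a set set"

locale matroid =
  fixes M :: "'a set_system"
  assumes finite_ground: "finite (ground M)"
    and indep_subset_ground: "I \<in> indep_sets M \<Longrightarrow> I \<subseteq> ground M"
    and indep_empty: "{} \<in> indep_sets M"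
    and indep_subset: "\<lbrakk>I \<in> indep_sets M; J \<subseteq> I\<rbrakk> \<Longrightarrow> J \<in> indep_sets M"
    and augment: "\<lbrakk>I \<in> indep_sets M; J \<in> indep_sets M; card I < card J\<rbrakk>
      \<Longrightarrow> \<exists>e\<in>J - I. insert e I \<in> indep_sets M"

definition basis_of :: "'a set_system \<Rightarrow> 'a set \<Rightarrow> 'a set \<Rightarrow> bool" where
  "basis_of M X B \<longleftrightarrow> B \<subseteq> X \<and> B \<in> indep_sets M \<and>
     (\<forall>C \<in> indep_sets M. B \<subseteq> C \<and> C \<subseteq> X \<longrightarrow> C = B)"

definition rank_of :: "'a set_system \<Rightarrow> 'a set \<Rightarrow> nat" where
  "rank_of M X = Max (card ` {I \<in> indep_sets M. I \<subseteq> X})"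

definition closure_of :: "'a set_system \<Rightarrow> 'a set \<Rightarrow> 'a set" where
  "closure_of M X = {e \<in> ground M. rank_of M (insert e X) = rank_of M X}"

text \<open>The lattice of flats, ordered by inclusion. Its minimum is the set of loops
  \<open>closure_of M {}\<close> and its maximum is \<open>ground M\<close>;
  see \<open>closure_empty_least_flat\<close> and \<open>ground_greatest_flat\<close> below.\<close>

definition flats :: "'a set_system \<Rightarrow> 'a set set" where
  "flats M = {F. F \<subseteq> ground M \<and> closure_of M F = F}"

definition restriction :: "'a set_system \<Rightarrow> 'a set \<Rightarrow> 'a set_system" where
  "restriction M X = \<lparr>ground = X, indep_sets = {I \<in> indep_sets M. I \<subseteq> X}\<rparr>"

definition contraction :: "'a set_system \<Rightarrow> 'a set \<Rightarrow> 'a set_system" where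
  "contraction M X = \<lparr>ground = ground M - X,
     indep_sets = {I. I \<subseteq> ground M - X \<and> (\<exists>B. basis_of M X B \<and> I \<union> B \<in> indep_sets M)}\<rparr>"


section \<open>Complexes attached to a matroid\<close>

definition independence_complex :: "'a set_system \<Rightarrow> 'a set set" where
  "independence_complex M = indep_sets M"

definition bergman_complex :: "'a set_system \<Rightarrow> 'a set set set" where
  "bergman_complex M = {C. subset.chain (flats M - {closure_of M {}, ground M}) C}"

text \<open>The vertex \<open>u\<^sub>i\<close> is encoded as \<open>Inl i\<close> and \<open>v\<^sub>F\<close> as \<open>Inr F\<close>. The list \<open>Fs\<close> is
  \<open>F\<^sub>1 \<subset> \<dots> \<subset> F\<^sub>k\<close>; the empty list is the case \<open>k = 0\<close>.\<close>

definition augmented_bergman_complex :: "'a set_system \<Rightarrow> ('a + 'a set) set set" where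
  "augmented_bergman_complex M =
     {Inl ` S \<union> Inr ` set Fs | S Fs.
        S \<in> indep_sets M \<and> set Fs \<subseteq> flats M - {ground M} \<and>
        sorted_wrt (\<subset>) Fs \<and> (Fs \<noteq> [] \<longrightarrow> S \<subseteq> hd Fs)}"


section \<open>Consistency of the definitions\<close>

context matroid
begin

lemma finite_indep: "I \<in> indep_sets M \<Longrightarrow> finite I"
  using finite_ground finite_subset indep_subset_ground by blast

lemma finite_indep_sets: "finite (indep_sets M)"
  using finite_ground indep_subset_ground by (auto intro: finite_subset[of _ "Pow (ground M)"])

lemma basis_extends:
  assumes "I \<in> indep_sets M" "I \<subseteq> X"
  obtains B where "basis_of M X B" "I \<subseteq> B"
proof -
  let ?A = "{C \<in> indep_sets M. C \<subseteq> X}"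
  have "finite ?A" "I \<in> ?A" using finite_indep_sets assms by auto
  from finite_has_maximal2[OF this] obtain B where
    "B \<in> ?A" "I \<subseteq> B" "\<forall>C\<in>?A. B \<subseteq> C \<longrightarrow> B = C" by auto
  then show ?thesis by (intro that[of B]) (auto simp: basis_of_def)
qed

lemma card_le_basis:
  assumes "basis_of M X B" "I \<in> indep_sets M" "I \<subseteq> X"
  shows "card I \<le> card B"
proof (rule ccontr)
  assume "\<not> card I \<le> card B"
  then obtain e where "e \<in> I - B" "insert e B \<in> indep_sets M"
    using augment[of B I] assms by (auto simp: basis_of_def)
  then show False using assms by (auto simp: basis_of_def)
qed

lemma rank_of_basis: "basis_of M X B \<Longrightarrow> rank_of M X = card B"
  unfolding rank_of_def
  by (rule Max_eqI) (use finite_indep_sets card_le_basis in \<open>auto simp: basis_of_def\<close>)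

lemma card_le_rank:
  assumes "I \<in> indep_sets M" "I \<subseteq> X" shows "card I \<le> rank_of M X"
  by (metis assms basis_extends card_le_basis rank_of_basis)

lemma matroid_restriction:
  assumes "X \<subseteq> ground M" shows "matroid (restriction M X)"
proof
  show "finite (ground (restriction M X))"
    using assms finite_ground finite_subset by (auto simp: restriction_def)
next
  fix I J
  assume "I \<in> indep_sets (restriction M X)" "J \<in> indep_sets (restriction M X)" "card I < card J"
  then show "\<exists>e\<in>J - I. insert e I \<in> indep_sets (restriction M X)"
    using augment[of I J] by (auto simp: restriction_def)
next
  fix I J assume "I \<in> indep_sets (restriction M X)" "J \<subseteq> I"
  then show "J \<in> indep_sets (restriction M X)"
    using indep_subset[of I J] by (auto simp: restriction_def)
qed (auto simp: restriction_def indep_empty)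

lemma matroid_contraction: "matroid (contraction M X)"
proof
  show "finite (ground (contraction M X))"
    using finite_ground by (simp add: contraction_def)
next
  fix I assume "I \<in> indep_sets (contraction M X)"
  then show "I \<subseteq> ground (contraction M X)" by (simp add: contraction_def)
next
  obtain B where "basis_of M X B" using basis_extends[OF indep_empty] by blast
  then show "{} \<in> indep_sets (contraction M X)"
    by (auto simp: contraction_def basis_of_def)
next
  fix I J assume "I \<in> indep_sets (contraction M X)" "J \<subseteq> I"
  then show "J \<in> indep_sets (contraction M X)"
    unfolding contraction_def
    by simp (metis Un_mono indep_subset order_refl subset_trans)
next
  fix I J
  assume I: "I \<in> indep_sets (contraction M X)" and J: "J \<in> indep_sets (contraction M X)"
    and less: "card I < card J"
  from I obtain B where B: "basis_of M X B" "I \<union> B \<in> indep_sets M" "I \<subseteq> ground M - X"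
    by (auto simp: contraction_def)
  from J obtain B' where B': "basis_of M X B'" "J \<union> B' \<in> indep_sets M" "J \<subseteq> ground M - X"
    by (auto simp: contraction_def)
  have "card B = card B'" using B B' rank_of_basis by metis
  moreover have "card (I \<union> B) = card I + card B"
    using B finite_indep[OF B(2)] by (intro card_Un_disjoint) (auto simp: basis_of_def)
  moreover have "card (J \<union> B') = card J + card B'"
    using B' finite_indep[OF B'(2)] by (intro card_Un_disjoint) (auto simp: basis_of_def)
  ultimately obtain e where e: "e \<in> (J \<union> B') - (I \<union> B)" "insert e (I \<union> B) \<in> indep_sets M"
    using augment[OF B(2) B'(2)] less by auto
  have "insert e B \<in> indep_sets M" using e(2) by (rule indep_subset) auto
  then have "e \<notin> X" using e(1) B(1) by (auto simp: basis_of_def)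
  then have "e \<in> J - I" using e(1) B'(1) by (auto simp: basis_of_def)
  moreover have "insert e I \<in> indep_sets (contraction M X)"
    using e B B' \<open>e \<in> J - I\<close> by (auto simp: contraction_def)
  ultimately show "\<exists>e\<in>J - I. insert e I \<in> indep_sets (contraction M X)" by blast
qed

lemma subset_closure: "X \<subseteq> ground M \<Longrightarrow> X \<subseteq> closure_of M X"
  by (auto simp: closure_of_def insert_absorb)

lemma ground_greatest_flat: "ground M \<in> flats M" "F \<in> flats M \<Longrightarrow> F \<subseteq> ground M"
  by (auto simp: flats_def closure_of_def insert_absorb)

lemma closure_empty: "closure_of M {} = {e \<in> ground M. {e} \<notin> indep_sets M}"
proof -
  have r0: "rank_of M {} = 0"
    using rank_of_basis[of "{}" "{}"] indep_empty by (auto simp: basis_of_def)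
  have "rank_of M {e} = 0 \<longleftrightarrow> {e} \<notin> indep_sets M" for e
  proof
    assume "rank_of M {e} = 0"
    then show "{e} \<notin> indep_sets M" using card_le_rank[of "{e}" "{e}"] by auto
  next
    assume "{e} \<notin> indep_sets M"
    then have "basis_of M {e} {}" using indep_empty by (auto simp: basis_of_def subset_singleton_iff)
    then show "rank_of M {e} = 0" using rank_of_basis[of "{e}" "{}"] by simp
  qed
  then show ?thesis by (simp add: closure_of_def r0)
qed

lemma loop_in_closure:
  assumes "e \<in> ground M" "{e} \<notin> indep_sets M" shows "e \<in> closure_of M X"
proof -
  have "e \<notin> I" if "I \<in> indep_sets M" for I
    using assms(2) indep_subset[OF that, of "{e}"] by auto
  then have "{I \<in> indep_sets M. I \<subseteq> insert e X} = {I \<in> indep_sets M. I \<subseteq> X}"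
    by blast
  then show ?thesis using assms(1) by (simp add: closure_of_def rank_of_def)
qed

lemma closure_empty_least_flat:
  "closure_of M {} \<in> flats M" "F \<in> flats M \<Longrightarrow> closure_of M {} \<subseteq> F"
proof -
  let ?L = "closure_of M {}"
  have "{e} \<in> indep_sets M \<Longrightarrow> rank_of M ?L < rank_of M (insert e ?L)" for e
  proof -
    assume e: "{e} \<in> indep_sets M"
    have "basis_of M ?L {}" unfolding basis_of_def
    proof (intro conjI ballI impI)
      fix C assume C: "C \<in> indep_sets M" "{} \<subseteq> C \<and> C \<subseteq> ?L"
      have False if "x \<in> C" for x
        using that C indep_subset[OF C(1), of "{x}"] by (auto simp: closure_empty)
      then show "C = {}" by blast
    qed (auto simp: indep_empty)
    then have "rank_of M ?L = 0" using rank_of_basis[of ?L "{}"] by simp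
    moreover have "card {e} \<le> rank_of M (insert e ?L)" using e by (intro card_le_rank) auto
    ultimately show ?thesis by simp
  qed
  then have "x \<in> ?L" if "x \<in> closure_of M ?L" for x
    using that by (cases "{x} \<in> indep_sets M")
      (fastforce simp: closure_of_def[of M ?L], simp add: closure_empty, simp add: closure_of_def)
  moreover have "?L \<subseteq> ground M" by (auto simp: closure_of_def)
  ultimately show "?L \<in> flats M" using subset_closure[of ?L] by (auto simp: flats_def)
  show "F \<in> flats M \<Longrightarrow> ?L \<subseteq> F"
    using loop_in_closure[of _ F] by (auto simp: closure_empty flats_def)
qed

lemma finite_flats: "finite (flats M)"
  using finite_ground by (auto simp: flats_def intro: finite_subset[of _ "Pow (ground M)"])

lemma simplicial_complex_independence: "simplicial_complex (independence_complex M)"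
  by (auto simp: simplicial_complex_def independence_complex_def finite_indep_sets indep_empty
      finite_indep intro: indep_subset)

lemma simplicial_complex_bergman: "simplicial_complex (bergman_complex M)"
proof -
  have "bergman_complex M \<subseteq> Pow (flats M)"
    by (auto simp: bergman_complex_def subset_chain_def)
  then have "finite (bergman_complex M)" "\<forall>C\<in>bergman_complex M. finite C"
    using finite_flats finite_subset by blast+
  then show ?thesis
    by (auto simp: simplicial_complex_def bergman_complex_def subset_chain_def subset_iff)
qed

lemma simplicial_complex_augmented_bergman: "simplicial_complex (augmented_bergman_complex M)"
proof -
  let ?\<Delta> = "augmented_bergman_complex M"
  let ?V = "Inl ` ground M \<union> Inr ` flats M"
  have V: "finite ?V" using finite_ground finite_flats by simp
  have sub: "?\<Delta> \<subseteq> Pow ?V"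
    using indep_subset_ground by (fastforce simp: augmented_bergman_complex_def)
  have "finite ?\<Delta>" using V sub by (meson finite_Pow_iff finite_subset)
  moreover have "\<forall>F\<in>?\<Delta>. finite F" using V sub finite_subset by blast
  moreover have "{} \<in> ?\<Delta>" unfolding augmented_bergman_complex_def using indep_empty
    by (intro CollectI exI[of _ "{}"] exI[of _ "[]"]) auto
  moreover have "G \<in> ?\<Delta>" if F: "F \<in> ?\<Delta>" and G: "G \<subseteq> F" for F G
  proof -
    from F obtain S Fs where *: "F = Inl ` S \<union> Inr ` set Fs" "S \<in> indep_sets M"
      "set Fs \<subseteq> flats M - {ground M}" "sorted_wrt (\<subset>) Fs" "Fs \<noteq> [] \<longrightarrow> S \<subseteq> hd Fs"
      by (auto simp: augmented_bergman_complex_def)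
    define T where "T = {i. Inl i \<in> G}"
    define Gs where "Gs = filter (\<lambda>A. Inr A \<in> G) Fs"
    have T: "T \<subseteq> S" using G *(1) by (auto simp: T_def)
    have "G = Inl ` T \<union> Inr ` set Gs"
    proof (rule set_eqI)
      fix z show "z \<in> G \<longleftrightarrow> z \<in> Inl ` T \<union> Inr ` set Gs"
        using G *(1) by (cases z) (auto simp: T_def Gs_def)
    qed
    moreover have "T \<in> indep_sets M" using T *(2) indep_subset by blast
    moreover have "T \<subseteq> hd Gs" if "Gs \<noteq> []"
    proof -
      have "hd Gs \<in> set Fs" using hd_in_set[OF that] by (auto simp: Gs_def)
      then have "hd Fs \<subseteq> hd Gs" "Fs \<noteq> []" using *(4) by (cases Fs; auto)+
      then show ?thesis using T *(5) by auto
    qed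
    moreover have "sorted_wrt (\<subset>) Gs" using *(4) by (simp add: Gs_def sorted_wrt_filter)
    moreover have "set Gs \<subseteq> flats M - {ground M}" using *(3) by (auto simp: Gs_def)
    ultimately show ?thesis unfolding augmented_bergman_complex_def by blast
  qed
  ultimately show ?thesis by (auto simp: simplicial_complex_def)
qed

end

end

theory Submission
  imports Defs
begin

text \<open>A face of the augmented Bergman complex containing some \<open>v\<^sub>G\<close> is determined by its least flat
  \<open>F\<close>, an independent subset of \<open>F\<close>, and a chain of flats strictly between \<open>F\<close> and \<open>E\<close>. The latter
  chains form the Bergman complex of \<open>M/F\<close>. Since \<open>rk M - 1 = rk F + (rk M - rk F - 1)\<close>, the weights
  of the faces with least flat \<open>F\<close> factor as \<open>x\<close> times a product, the exponent of
  \<open>1 - x\<close> splitting accordingly.\<close>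

section \<open>Dimensions of complexes, and chains as sorted lists\<close>

text \<open>A face of size \<open>d\<close> that bounds all others makes the dimension
  \<open>d - 1\<close>. Later \<open>d\<close> is always a rank expression, so the maximum in
  \<open>complex_dim\<close> disappears from the calculations.\<close>

lemma h_poly_eqI:
  assumes "finite \<Delta>" "\<And>F. F \<in> \<Delta> \<Longrightarrow> card F \<le> d" "F\<^sub>0 \<in> \<Delta>" "card F\<^sub>0 = d"
  shows "h_poly \<Delta> = (\<Sum>F\<in>\<Delta>. [:0, 1:] ^ card F * (1 - [:0, 1:]) ^ (d - card F))"
proof -
  have "complex_dim \<Delta> = int d - 1"
    unfolding complex_dim_def
  proof (rule Max_eqI)
    show "int d - 1 \<in> (\<lambda>F. int (card F) - 1) ` \<Delta>" using assms(3,4) by blast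
  qed (use assms(1,2) in \<open>force+\<close>)
  then show ?thesis by (simp add: h_poly_def)
qed

text \<open>Translates between the two encodings of chains: sets in \<open>bergman_complex\<close>,
  lists in \<open>augmented_bergman_complex\<close>. A minimal member of a chain is its least one,
  so it can be put in front of a sorted list of the others.\<close>

lemma finite_subset_chain_sorted_list:
  assumes "finite C" "subset.chain A C"
  obtains Fs where "set Fs = C" "sorted_wrt (\<subset>) Fs"
proof -
  have "\<exists>Fs. set Fs = C \<and> sorted_wrt (\<subset>) Fs"
    using assms
  proof (induction C rule: finite_psubset_induct)
    case (psubset C)
    show ?case
    proof (cases "C = {}")
      case False
      then obtain m where m: "m \<in> C" "\<forall>b\<in>C. b \<subseteq> m \<longrightarrow> m = b"
        using finite_has_minimal[OF psubset.hyps] by blast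
      have "subset.chain A (C - {m})"
        using psubset.prems by (auto simp: subset_chain_def)
      then obtain Fs where Fs: "set Fs = C - {m}" "sorted_wrt (\<subset>) Fs"
        using psubset.IH[of "C - {m}"] m(1) by blast
      have "\<forall>b\<in>C - {m}. m \<subset> b"
      proof
        fix b assume b: "b \<in> C - {m}"
        then have "b \<subseteq> m \<or> m \<subseteq> b" using m(1) psubset.prems by (auto simp: subset_chain_def)
        then show "m \<subset> b" using b m(2) by blast
      qed
      then show ?thesis using Fs m(1) by (intro exI[of _ "m # Fs"]) auto
    qed simp
  qed
  then show ?thesis using that by blast
qed

lemma sorted_wrt_psubset_subset_chain:
  "sorted_wrt (\<subset>) Fs \<Longrightarrow> set Fs \<subseteq> A \<Longrightarrow> subset.chain A (set Fs)"
  by (induction Fs) (auto simp: subset_chain_def)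

section \<open>Rank, closure and flats\<close>

context matroid
begin

lemma obtain_basis:
  obtains B where "basis_of M X B"
  using basis_extends[OF indep_empty, of X] by blast

lemma rank_of_mono: "X \<subseteq> Y \<Longrightarrow> rank_of M X \<le> rank_of M Y"
  by (rule obtain_basis[of X]) (auto simp: rank_of_basis basis_of_def intro!: card_le_rank)

text \<open>Removing \<open>e\<close> from a basis of \<open>insert e X\<close> leaves an
  independent subset of \<open>X\<close>.\<close>

lemma rank_of_insert_le: "rank_of M (insert e X) \<le> Suc (rank_of M X)"
proof -
  obtain B where B: "basis_of M (insert e X) B" by (rule obtain_basis)
  then have "card (B - {e}) \<le> rank_of M X"
    by (intro card_le_rank) (auto simp: basis_of_def intro: indep_subset)
  moreover have "card B \<le> Suc (card (B - {e}))"
    using diff_card_le_card_Diff[of "{e}" B] by simp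
  ultimately show ?thesis using rank_of_basis[OF B] by linarith
qed

text \<open>A basis \<open>B\<close> of \<open>X\<close> stays maximal in the closure: if some
  closure element \<open>e\<close> extended \<open>B\<close>, then \<open>insert e X\<close> would
  have larger rank than \<open>X\<close>.\<close>

lemma rank_of_closure:
  assumes "X \<subseteq> ground M" shows "rank_of M (closure_of M X) = rank_of M X"
proof -
  obtain B where B: "basis_of M X B" by (rule obtain_basis)
  have "basis_of M (closure_of M X) B"
    unfolding basis_of_def
  proof (intro conjI ballI impI)
    fix C assume C: "C \<in> indep_sets M" "B \<subseteq> C \<and> C \<subseteq> closure_of M X"
    show "C = B"
    proof (rule ccontr)
      assume "C \<noteq> B"
      then obtain e where e: "e \<in> C" "e \<notin> B" using C by blast
      have "insert e B \<in> indep_sets M" using C e by (intro indep_subset[OF C(1)]) auto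
      then have "card (insert e B) \<le> rank_of M (insert e X)"
        using B by (intro card_le_rank) (auto simp: basis_of_def)
      also have "\<dots> = card B" using e C rank_of_basis[OF B] by (auto simp: closure_of_def)
      finally show False using e B finite_indep by (auto simp: basis_of_def)
    qed
  qed (use B subset_closure[OF assms] in \<open>auto simp: basis_of_def\<close>)
  then show ?thesis using rank_of_basis B by metis
qed

text \<open>If \<open>e\<close> does not raise the rank of the closure, then the rank of
  \<open>insert e X\<close> is squeezed between the rank of \<open>X\<close> and that of the
  closure, which agree.\<close>

lemma closure_in_flats:
  assumes "X \<subseteq> ground M" shows "closure_of M X \<in> flats M"
proof -
  let ?L = "closure_of M X"
  have L: "?L \<subseteq> ground M" by (auto simp: closure_of_def)
  have "e \<in> ?L" if "e \<in> closure_of M ?L" for e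
  proof -
    have "rank_of M (insert e X) \<le> rank_of M (insert e ?L)"
      using subset_closure[OF assms] by (intro rank_of_mono) auto
    moreover have "e \<in> ground M" "rank_of M (insert e ?L) = rank_of M ?L"
      using that by (simp_all add: closure_of_def[of M ?L])
    moreover have "rank_of M X \<le> rank_of M (insert e X)" by (rule rank_of_mono) auto
    ultimately show ?thesis
      using rank_of_closure[OF assms] unfolding closure_of_def[of M X] by simp
  qed
  then show ?thesis using L subset_closure[OF L] by (auto simp: flats_def)
qed

text \<open>Since \<open>F\<close> is closed, any single point of \<open>G\<close> outside
  \<open>F\<close> already raises the rank.\<close>

lemma rank_of_flat_strict_mono:
  assumes "F \<in> flats M" "G \<subseteq> ground M" "F \<subset> G"
  shows "rank_of M F < rank_of M G"
proof -
  obtain e where e: "e \<in> G" "e \<notin> F" using assms(3) by blast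
  then have "rank_of M (insert e F) \<noteq> rank_of M F"
    using assms by (auto simp: flats_def closure_of_def)
  moreover have "rank_of M F \<le> rank_of M (insert e F)" by (rule rank_of_mono) auto
  moreover have "rank_of M (insert e F) \<le> rank_of M G" using e assms by (intro rank_of_mono) auto
  ultimately show ?thesis by linarith
qed

section \<open>Rank, closure and flats of a contraction\<close>

text \<open>Extend a basis \<open>B\<close> of \<open>X\<close> to a basis \<open>B'\<close> of
  \<open>A \<union> X\<close>; then \<open>B' - B\<close> is a basis of \<open>A\<close> in the
  contraction. The additive form avoids truncated subtraction.\<close>

lemma rank_of_contraction:
  assumes "A \<subseteq> ground M - X"
  shows "rank_of (contraction M X) A + rank_of M X = rank_of M (A \<union> X)"
proof -
  interpret N: matroid "contraction M X" by (rule matroid_contraction)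
  obtain B where B: "basis_of M X B" by (rule obtain_basis)
  then obtain B' where B': "basis_of M (A \<union> X) B'" "B \<subseteq> B'"
    using basis_extends[of B "A \<union> X"] by (auto simp: basis_of_def)
  have fin: "finite B'" using B'(1) finite_indep by (auto simp: basis_of_def)
  have "B' \<inter> X \<in> indep_sets M" using B'(1) by (auto simp: basis_of_def intro: indep_subset)
  \<comment> \<open>\<open>B' \<inter> X\<close> is independent and contains \<open>B\<close>, which
    is maximal in \<open>X\<close>.\<close>
  then have int: "B' \<inter> X = B" using B B' by (auto simp: basis_of_def)
  have card: "card (B' - B) + card B = card B'"
    using B'(2) fin by (metis card_Diff_subset card_mono finite_subset le_add_diff_inverse2)
  have "basis_of (contraction M X) A (B' - B)"
    unfolding basis_of_def
  proof (intro conjI ballI impI)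
    show sub: "B' - B \<subseteq> A" using int B'(1) by (auto simp: basis_of_def)
    have "(B' - B) \<union> B = B'" using B' by blast
    then show "B' - B \<in> indep_sets (contraction M X)"
      using sub assms B B' by (auto simp: contraction_def basis_of_def[of M "A \<union> X"])
  next
    fix C assume C: "C \<in> indep_sets (contraction M X)" "B' - B \<subseteq> C \<and> C \<subseteq> A"
    \<comment> \<open>The witness \<open>D\<close> may differ from \<open>B\<close>, but all bases
      of \<open>X\<close> have the same size, so counting suffices for maximality.\<close>
    then obtain D where D: "basis_of M X D" "C \<union> D \<in> indep_sets M" "C \<subseteq> ground M - X"
      by (auto simp: contraction_def)
    have finC: "finite C" "finite D" using finite_indep[OF D(2)] by auto
    have "card C + card D = card (C \<union> D)"
      using D finC by (subst card_Un_disjoint) (auto simp: basis_of_def)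
    also have "\<dots> \<le> card B'"
      using C D by (intro card_le_basis[OF B'(1) D(2)]) (auto simp: basis_of_def)
    finally have "card C \<le> card (B' - B)"
      using card rank_of_basis[OF B] rank_of_basis[OF D(1)] by linarith
    then show "C = B' - B" using C finC card_seteq[of C "B' - B"] by auto
  qed
  then show ?thesis using N.rank_of_basis rank_of_basis[OF B] rank_of_basis[OF B'(1)] card by simp
qed

text \<open>By the rank formula both ranks in the closure condition shift by the same amount
  \<open>rank_of M F\<close>.\<close>

lemma closure_of_contraction:
  assumes "F \<subseteq> ground M" "A \<subseteq> ground M - F"
  shows "closure_of (contraction M F) A = closure_of M (A \<union> F) - F"
proof -
  have "rank_of (contraction M F) (insert e A) = rank_of (contraction M F) A \<longleftrightarrow>
      rank_of M (insert e (A \<union> F)) = rank_of M (A \<union> F)" if "e \<in> ground M - F" for e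
    using rank_of_contraction[of "insert e A" F] rank_of_contraction[of A F] that assms by auto
  then show ?thesis by (auto simp: closure_of_def contraction_def)
qed

text \<open>The maps \<open>A \<union> F\<close> and \<open>G - F\<close> are mutually inverse
  between the flats of the contraction and the flats of \<open>M\<close> containing
  \<open>F\<close>.\<close>

lemma flats_contraction:
  assumes "F \<in> flats M"
  shows "flats (contraction M F) = (\<lambda>G. G - F) ` {G \<in> flats M. F \<subseteq> G}"
proof -
  have F: "F \<subseteq> ground M" using assms ground_greatest_flat by blast
  \<comment> \<open>The closure of \<open>A \<union> F\<close> contains \<open>F\<close>, so it
    equals \<open>A\<close> after removing \<open>F\<close> exactly when it is
    \<open>A \<union> F\<close> itself.\<close>
  have *: "closure_of (contraction M F) A = A \<longleftrightarrow> A \<union> F \<in> flats M" if A: "A \<subseteq> ground M - F" for A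
    using closure_of_contraction[OF F A] subset_closure[of "A \<union> F"] A F by (auto simp: flats_def)
  show ?thesis
  proof (intro set_eqI iffI)
    fix A assume "A \<in> flats (contraction M F)"
    then have A: "A \<subseteq> ground M - F" "closure_of (contraction M F) A = A"
      by (simp_all add: flats_def) (simp add: contraction_def)
    then have "A \<union> F \<in> flats M" using *[OF A(1)] by simp
    then show "A \<in> (\<lambda>G. G - F) ` {G \<in> flats M. F \<subseteq> G}"
      using A(1) by (intro image_eqI[of _ _ "A \<union> F"]) auto
  next
    fix A assume "A \<in> (\<lambda>G. G - F) ` {G \<in> flats M. F \<subseteq> G}"
    then obtain G where G: "A = G - F" "G \<in> flats M" "F \<subseteq> G" by blast
    have A: "A \<union> F = G" "A \<subseteq> ground M - F" using G ground_greatest_flat(2)[OF G(2)] by auto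
    then show "A \<in> flats (contraction M F)"
      using *[OF A(2)] G(2) by (simp add: flats_def[of "contraction M F"])
        (simp add: contraction_def)
  qed
qed

section \<open>Chains of flats above a flat and the Bergman complex of the contraction\<close>

text \<open>An open interval of the lattice of flats of \<open>M\<close>; it stands in for the
  proper part of the lattice of flats of M/F, so that chains can be handled inside
  \<open>M\<close>.\<close>

definition flats_above :: "'a set \<Rightarrow> 'a set set" where
  "flats_above F = {G \<in> flats M. F \<subset> G \<and> G \<subset> ground M}"

lemma proper_flats_contraction:
  assumes "F \<in> flats M"
  shows "flats (contraction M F) - {closure_of (contraction M F) {}, ground (contraction M F)}
    = (\<lambda>G. G - F) ` flats_above F"
proof -
  have F: "F \<subseteq> ground M" "closure_of M F = F" using assms by (auto simp: flats_def)
  \<comment> \<open>As \<open>F\<close> is closed, the contraction has no loops and its least flat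
    is empty. The two excluded flats thus come from \<open>G = F\<close> and
    \<open>G = ground M\<close>.\<close>
  have ends: "closure_of (contraction M F) {} = {}" "ground (contraction M F) = ground M - F"
    using closure_of_contraction[of F "{}"] F by (auto simp: contraction_def)
  have "G \<in> flats M \<and> F \<subseteq> G \<and> G - F \<notin> {{}, ground M - F} \<longleftrightarrow> G \<in> flats_above F" for G
  proof (cases "G \<in> flats M \<and> F \<subseteq> G")
    case True
    then have "G \<subseteq> ground M" using ground_greatest_flat(2) by simp
    then have "G - F = {} \<longleftrightarrow> G = F" "G - F = ground M - F \<longleftrightarrow> G = ground M"
      using True F(1) by blast+
    then show ?thesis using True \<open>G \<subseteq> ground M\<close> by (simp add: flats_above_def psubset_eq) metis
  qed (auto simp: flats_above_def)
  then have "flats_above F = {G \<in> {G \<in> flats M. F \<subseteq> G}. G - F \<notin> {{}, ground M - F}}"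
    by (intro set_eqI) simp
  then show ?thesis unfolding flats_contraction[OF assms] ends by (simp only:) blast
qed

lemma inj_on_Diff_flats_above: "inj_on (\<lambda>G. G - F) (flats_above F)"
  by (rule inj_onI) (auto simp: flats_above_def)

text \<open>All sets involved contain \<open>F\<close>, so deleting \<open>F\<close> both preserves
  and reflects inclusion; chains therefore correspond to chains.\<close>

lemma bergman_complex_contraction:
  assumes "F \<in> flats M"
  shows "bergman_complex (contraction M F)
    = (\<lambda>C. (\<lambda>G. G - F) ` C) ` {C. subset.chain (flats_above F) C}"
proof -
  have "subset.chain ((\<lambda>G. G - F) ` flats_above F) D \<longleftrightarrow>
      (\<exists>C. subset.chain (flats_above F) C \<and> D = (\<lambda>G. G - F) ` C)" for D
  proof
    assume D: "subset.chain ((\<lambda>G. G - F) ` flats_above F) D"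
    then obtain C where C: "C \<subseteq> flats_above F" "D = (\<lambda>G. G - F) ` C"
      by (metis subset_chain_def subset_image_iff)
    have "X \<subseteq> Y \<or> Y \<subseteq> X" if "X \<in> C" "Y \<in> C" for X Y
    proof -
      have "X - F \<subseteq> Y - F \<or> Y - F \<subseteq> X - F" using that D C by (auto simp: subset_chain_def)
      moreover have "F \<subseteq> X" "F \<subseteq> Y" using that C by (auto simp: flats_above_def)
      ultimately show ?thesis by blast
    qed
    then show "\<exists>C. subset.chain (flats_above F) C \<and> D = (\<lambda>G. G - F) ` C"
      using C by (auto simp: subset_chain_def)
  next
    assume "\<exists>C. subset.chain (flats_above F) C \<and> D = (\<lambda>G. G - F) ` C"
    then obtain C where C: "C \<subseteq> flats_above F" "\<forall>X\<in>C. \<forall>Y\<in>C. X \<subseteq> Y \<or> Y \<subseteq> X"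
      and D: "D = (\<lambda>G. G - F) ` C" unfolding subset_chain_def by blast
    have "X - F \<subseteq> Y - F \<or> Y - F \<subseteq> X - F" if "X \<in> C" "Y \<in> C" for X Y
      using C(2) that by (meson Diff_mono order_refl)
    then show "subset.chain ((\<lambda>G. G - F) ` flats_above F) D"
      unfolding subset_chain_def D using C(1) by (simp add: image_mono)
  qed
  then show ?thesis
    unfolding bergman_complex_def proper_flats_contraction[OF assms] by auto
qed

lemma finite_chain_flats_above: "subset.chain (flats_above F) C \<Longrightarrow> finite C"
  using finite_flats finite_subset[of C "flats M"] by (auto simp: subset_chain_def flats_above_def)

lemma finite_chains_flats_above: "finite {C. subset.chain (flats_above F) C}"
  by (rule finite_subset[of _ "Pow (flats M)"])
    (use finite_flats in \<open>auto simp: subset_chain_def flats_above_def\<close>)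

text \<open>Rank is injective on a chain of flats, with values strictly between the ranks of
  \<open>F\<close> and of the ground set.\<close>

lemma card_chain_flats_above:
  assumes "F \<in> flats M" "subset.chain (flats_above F) C"
  shows "card C \<le> rank_of M (ground M) - rank_of M F - 1"
proof -
  have C: "G \<in> flats M" "F \<subset> G" "G \<subset> ground M" if "G \<in> C" for G
    using that assms(2) by (auto simp: subset_chain_def flats_above_def)
  have "inj_on (rank_of M) C"
  proof (rule inj_onI)
    fix X Y assume XY: "X \<in> C" "Y \<in> C" "rank_of M X = rank_of M Y"
    then have "X \<subseteq> Y \<or> Y \<subseteq> X" using assms(2) by (auto simp: subset_chain_def)
    then show "X = Y"
      using rank_of_flat_strict_mono[of X Y] rank_of_flat_strict_mono[of Y X] C XY
      by (auto simp: psubset_eq)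
  qed
  moreover have "rank_of M ` C \<subseteq> {rank_of M F<..<rank_of M (ground M)}"
    using C rank_of_flat_strict_mono[OF assms(1)] rank_of_flat_strict_mono[of _ "ground M"]
    by (auto simp: psubset_eq)
  ultimately show ?thesis
    using card_inj_on_le[of "rank_of M" C "{rank_of M F<..<rank_of M (ground M)}"] by simp
qed

text \<open>The lattice of flats is graded by rank: pick a flat \<open>G\<close> covering
  \<open>F\<close> and put it below a longest chain above \<open>G\<close>, by induction on the
  number of intermediate ranks.\<close>

lemma maximal_chain_flats_above:
  assumes "F \<in> flats M - {ground M}"
  obtains C where "subset.chain (flats_above F) C"
    "card C = rank_of M (ground M) - rank_of M F - 1"
proof -
  have "\<exists>C. subset.chain (flats_above F) C \<and> card C = n"
    if "rank_of M (ground M) - rank_of M F - 1 = n" for n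
    using that assms
  proof (induction n arbitrary: F)
    case 0
    then show ?case by (intro exI[of _ "{}"]) (auto simp: subset_chain_def)
  next
    case (Suc n)
    have F: "F \<in> flats M" "F \<subset> ground M" using Suc.prems(2) ground_greatest_flat(2) by auto
    then obtain e where e: "e \<in> ground M" "e \<notin> F" by blast
    define G where "G = closure_of M (insert e F)"
    have eF: "insert e F \<subseteq> ground M" using e F by auto
    have G: "G \<in> flats M" "insert e F \<subseteq> G"
      using closure_in_flats[OF eF] subset_closure[OF eF] by (auto simp: G_def)
    have FG: "F \<subset> G" using G e by blast
    have "rank_of M G = rank_of M (insert e F)" using rank_of_closure[OF eF] by (simp add: G_def)
    \<comment> \<open>One new point raises the rank by at most one, and a strictly larger flat has
      rank at least one more.\<close>
    then have rG: "rank_of M G = Suc (rank_of M F)"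
      using rank_of_insert_le[of e F] rank_of_flat_strict_mono[OF F(1) _ FG]
        ground_greatest_flat(2)[OF G(1)] by auto
    \<comment> \<open>In the successor case the rank of \<open>M\<close> exceeds that of
      \<open>F\<close> by at least two.\<close>
    then have "G \<noteq> ground M" using Suc.prems(1) by auto
    moreover have "rank_of M (ground M) - rank_of M G - 1 = n" using Suc.prems(1) rG by auto
    ultimately obtain C where C: "subset.chain (flats_above G) C" "card C = n"
      using Suc.IH[of G] G by auto
    have "G \<notin> C" using C by (auto simp: subset_chain_def flats_above_def)
    then have "card (insert G C) = Suc n" using C finite_chain_flats_above by auto
    moreover have "G \<in> flats_above F"
      using G(1) FG \<open>G \<noteq> ground M\<close> ground_greatest_flat(2) by (simp add: flats_above_def psubset_eq)
    moreover have "flats_above G \<subseteq> flats_above F" using FG by (auto simp: flats_above_def)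
    moreover have "\<forall>H\<in>C. G \<subseteq> H" using C(1) by (auto simp: subset_chain_def flats_above_def)
    ultimately have "card (insert G C) = Suc n" "subset.chain (flats_above F) (insert G C)"
      using C(1) by (auto simp: subset_chain_def)
    then show ?case by blast
  qed
  then show ?thesis using that by blast
qed

section \<open>The h-polynomials of the summands in terms of ranks of \<open>M\<close>\<close>

text \<open>The sum is pulled back along the bijection \<open>G - F\<close>, which preserves the
  sizes of chains; a longest chain above \<open>F\<close> fixes the dimension.\<close>

lemma h_poly_bergman_contraction:
  assumes "F \<in> flats M - {ground M}"
  shows "h_poly (bergman_complex (contraction M F)) =
    (\<Sum>C | subset.chain (flats_above F) C. [:0, 1:] ^ card C *
      (1 - [:0, 1:]) ^ (rank_of M (ground M) - rank_of M F - 1 - card C))"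
proof -
  let ?T = "{C. subset.chain (flats_above F) C}"
  let ?f = "\<lambda>C. (\<lambda>G. G - F) ` C"
  have F: "F \<in> flats M" using assms by simp
  have inj: "inj_on ?f ?T"
  proof (rule inj_onI)
    fix C D assume "C \<in> ?T" "D \<in> ?T" "?f C = ?f D"
    then show "C = D"
      using inj_on_image_eq_iff[OF inj_on_Diff_flats_above, of C F D]
      by (auto simp: subset_chain_def)
  qed
  have card: "card (?f C) = card C" if "C \<in> ?T" for C
    using that inj_on_subset[OF inj_on_Diff_flats_above]
    by (intro card_image) (auto simp: subset_chain_def)
  obtain C\<^sub>0 where C\<^sub>0: "subset.chain (flats_above F) C\<^sub>0"
    "card C\<^sub>0 = rank_of M (ground M) - rank_of M F - 1"
    using maximal_chain_flats_above[OF assms] .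
  have "h_poly (?f ` ?T) = (\<Sum>D\<in>?f ` ?T. [:0, 1:] ^ card D *
      (1 - [:0, 1:]) ^ (rank_of M (ground M) - rank_of M F - 1 - card D))"
    by (rule h_poly_eqI[where F\<^sub>0 = "?f C\<^sub>0"])
      (use finite_chains_flats_above card card_chain_flats_above[OF F] C\<^sub>0 in auto)
  then show ?thesis
    unfolding bergman_complex_contraction[OF F] sum.reindex[OF inj] by (simp add: card)
qed

text \<open>A basis of \<open>X\<close> is a largest face, which gives the exponent
  \<open>rank_of M X\<close>.\<close>

lemma h_poly_independence_restriction:
  "h_poly (independence_complex (restriction M X)) =
    (\<Sum>S | S \<in> indep_sets M \<and> S \<subseteq> X. [:0, 1:] ^ card S * (1 - [:0, 1:]) ^ (rank_of M X - card S))"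
proof -
  obtain B where B: "basis_of M X B" by (rule obtain_basis)
  have "independence_complex (restriction M X) = {S. S \<in> indep_sets M \<and> S \<subseteq> X}"
    by (simp add: independence_complex_def restriction_def)
  moreover have "B \<in> {S. S \<in> indep_sets M \<and> S \<subseteq> X}" using B by (simp add: basis_of_def)
  moreover have "card B = rank_of M X" using rank_of_basis[OF B] by simp
  ultimately show ?thesis
    by (simp only:) (rule h_poly_eqI, use finite_indep_sets card_le_rank in auto)
qed

lemma h_poly_independence:
  "h_poly (independence_complex M) = (\<Sum>S\<in>indep_sets M. [:0, 1:] ^ card S *
      (1 - [:0, 1:]) ^ (rank_of M (ground M) - card S))"
proof -
  have "{S \<in> indep_sets M. S \<subseteq> ground M} = indep_sets M" using indep_subset_ground by blast
  then show ?thesis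
    using h_poly_independence_restriction[of "ground M"]
    by (simp add: independence_complex_def restriction_def)
qed

section \<open>Faces of the augmented Bergman complex, sorted by their least flat\<close>

text \<open>The triple \<open>(F, S, C)\<close> encodes the face whose least flat is \<open>F\<close>.\<close>

definition flat_face_data :: "('a set \<times> 'a set \<times> 'a set set) set" where
  "flat_face_data = (SIGMA F : flats M - {ground M}.
     {S. S \<in> indep_sets M \<and> S \<subseteq> F} \<times> {C. subset.chain (flats_above F) C})"

text \<open>\<open>F\<close> is kept out of \<open>C\<close> and added only here: once
  \<open>F\<close> is fixed, \<open>S\<close> and \<open>C\<close> vary independently, which is what
  produces a product of two sums.\<close>

definition flat_face :: "'a set \<times> 'a set \<times> 'a set set \<Rightarrow> ('a + 'a set) set" where
  "flat_face = (\<lambda>(F, S, C). Inl ` S \<union> Inr ` insert F C)"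

lemma finite_flat_face_data: "finite flat_face_data"
  unfolding flat_face_data_def
  using finite_flats finite_indep_sets finite_chains_flats_above by (intro finite_SigmaI) auto

text \<open>The \<open>Inl\<close> part of a face recovers \<open>S\<close>; the least flat in the
  \<open>Inr\<close> part recovers \<open>F\<close>, and the remaining flats form
  \<open>C\<close>.\<close>

lemma inj_on_flat_face: "inj_on flat_face flat_face_data"
proof (rule inj_onI)
  fix s t assume st: "s \<in> flat_face_data" "t \<in> flat_face_data" "flat_face s = flat_face t"
  obtain F S C F' S' C' where s: "s = (F, S, C)" and t: "t = (F', S', C')"
    using prod_cases3 by metis
  have chain: "subset.chain (flats_above F) C" "subset.chain (flats_above F') C'"
    using st(1,2) by (simp_all add: s t flat_face_data_def)
  have eq: "Inl ` S \<union> Inr ` insert F C = Inl ` S' \<union> Inr ` insert F' C'"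
    using st(3) by (simp only: s t flat_face_def prod.case)
  have "S = S'"
    using arg_cong[OF eq, of "\<lambda>A. {i. Inl i \<in> A}"] by auto
  moreover have ins: "insert F C = insert F' C'"
    using arg_cong[OF eq, of "\<lambda>A. {G. Inr G \<in> A}"] by (auto simp: image_iff)
  have above: "G \<in> C \<Longrightarrow> F \<subset> G" "G \<in> C' \<Longrightarrow> F' \<subset> G" for G
    using chain by (auto simp: subset_chain_def flats_above_def)
  have "F = F'"
  proof (rule ccontr)
    assume "F \<noteq> F'"
    \<comment> \<open>Each of the two flats would lie strictly above the other.\<close>
    then have "F \<in> C'" "F' \<in> C" using ins by auto
    then show False using above by blast
  qed
  moreover have "C = C'"
  proof -
    have "F \<notin> C" "F \<notin> C'" using above \<open>F = F'\<close> by auto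
    then show ?thesis using ins \<open>F = F'\<close> by (simp add: insert_ident)
  qed
  ultimately show "s = t" by (simp add: s t)
qed

text \<open>An empty list of flats gives a face of the independence complex. A list
  \<open>F # Gs\<close> gives the triple with \<open>C = set Gs\<close>; conversely \<open>C\<close>
  is sorted and \<open>F\<close> is placed in front.\<close>

lemma augmented_bergman_complex_eq:
  "augmented_bergman_complex M = (`) Inl ` indep_sets M \<union> flat_face ` flat_face_data"
proof (intro set_eqI iffI)
  fix A assume "A \<in> augmented_bergman_complex M"
  then obtain S Fs where *: "A = Inl ` S \<union> Inr ` set Fs" "S \<in> indep_sets M"
      "set Fs \<subseteq> flats M - {ground M}" "sorted_wrt (\<subset>) Fs" "Fs \<noteq> [] \<longrightarrow> S \<subseteq> hd Fs"
    by (auto simp: augmented_bergman_complex_def)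
  show "A \<in> (`) Inl ` indep_sets M \<union> flat_face ` flat_face_data"
  proof (cases Fs)
    case Nil
    then show ?thesis using * by auto
  next
    case (Cons F Gs)
    have "set Gs \<subseteq> flats_above F"
      using * Cons ground_greatest_flat(2) by (auto simp: flats_above_def)
    then have "subset.chain (flats_above F) (set Gs)"
      using sorted_wrt_psubset_subset_chain * Cons by auto
    then have "(F, S, set Gs) \<in> flat_face_data"
      using * Cons by (auto simp: flat_face_data_def)
    moreover have "A = flat_face (F, S, set Gs)" using * Cons by (auto simp: flat_face_def)
    ultimately show ?thesis by blast
  qed
next
  fix A assume "A \<in> (`) Inl ` indep_sets M \<union> flat_face ` flat_face_data"
  then consider S where "S \<in> indep_sets M" "A = Inl ` S"
    | F S C where "(F, S, C) \<in> flat_face_data" "A = flat_face (F, S, C)" by auto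
  then show "A \<in> augmented_bergman_complex M"
  proof cases
    case 1
    then show ?thesis unfolding augmented_bergman_complex_def
      by (intro CollectI exI[of _ S] exI[of _ "[]"]) auto
  next
    case (2 F S C)
    then have FSC: "F \<in> flats M" "F \<noteq> ground M" "S \<in> indep_sets M" "S \<subseteq> F"
      "subset.chain (flats_above F) C" by (auto simp: flat_face_data_def)
    obtain Fs where Fs: "set Fs = C" "sorted_wrt (\<subset>) Fs"
      using finite_subset_chain_sorted_list[OF finite_chain_flats_above] FSC(5) by metis
    have "C \<subseteq> flats_above F" using FSC(5) by (simp add: subset_chain_def)
    then show ?thesis unfolding augmented_bergman_complex_def
      using FSC Fs 2(2)
      by (intro CollectI exI[of _ S] exI[of _ "F # Fs"]) (auto simp: flat_face_def flats_above_def)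
  qed
qed

text \<open>The extra one counts the vertex of \<open>F\<close> and is the source of the factor
  \<open>x\<close> in the formula.\<close>

lemma card_flat_face:
  assumes "(F, S, C) \<in> flat_face_data"
  shows "card (flat_face (F, S, C)) = Suc (card S + card C)"
proof -
  have *: "S \<in> indep_sets M" "subset.chain (flats_above F) C"
    using assms by (auto simp: flat_face_data_def)
  then have "finite S" "finite C" "F \<notin> C"
    using finite_indep finite_chain_flats_above by (auto simp: subset_chain_def flats_above_def)
  moreover have "card (Inl ` S \<union> Inr ` insert F C :: ('a + 'a set) set) =
      card (Inl ` S :: ('a + 'a set) set) + card (Inr ` insert F C :: ('a + 'a set) set)"
    using \<open>finite S\<close> \<open>finite C\<close> by (intro card_Un_disjoint) auto
  moreover have "card (Inr ` insert F C :: ('a + 'a set) set) = card (insert F C)"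
    by (rule card_image) (rule inj_Inr)
  ultimately show ?thesis
    unfolding flat_face_def prod.case by (simp only: card_image inj_Inl card_insert_disjoint) simp
qed

text \<open>These bounds make every natural-number subtraction in the exponents of
  \<open>1 - x\<close> exact.\<close>

lemma flat_face_data_card_bounds:
  assumes "(F, S, C) \<in> flat_face_data"
  shows "card S \<le> rank_of M F" "card C \<le> rank_of M (ground M) - rank_of M F - 1"
    "rank_of M F < rank_of M (ground M)"
  using assms card_le_rank card_chain_flats_above rank_of_flat_strict_mono[of F "ground M"]
    ground_greatest_flat(2)[of F]
  by (auto simp: flat_face_data_def)

section \<open>Summation over the faces of the augmented Bergman complex\<close>

lemma h_poly_augmented_bergman:
  "h_poly (augmented_bergman_complex M) =
    h_poly (independence_complex M) +
    [:0, 1:] * (\<Sum>F \<in> flats M - {ground M}.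
      h_poly (independence_complex (restriction M F)) * h_poly (bergman_complex (contraction M F)))"
proof -
  let ?x = "[:0, 1:] :: int poly"
  define r where "r = rank_of M (ground M)"
  define w where "w A = ?x ^ card A * (1 - ?x) ^ (r - card A)" for A :: "('a + 'a set) set"
  obtain B where B: "basis_of M (ground M) B" by (rule obtain_basis)
  have card_Inl: "card (Inl ` S :: ('a + 'a set) set) = card S" for S :: "'a set"
    by (simp add: card_image)
  have fin: "finite (augmented_bergman_complex M)"
    using simplicial_complex_augmented_bergman by (simp add: simplicial_complex_def)
  have bound: "card A \<le> r" if "A \<in> augmented_bergman_complex M" for A
    using that unfolding augmented_bergman_complex_eq
  proof
    assume "A \<in> (`) Inl ` indep_sets M"
    then show ?thesis using card_Inl card_le_rank indep_subset_ground by (auto simp: r_def)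
  next
    assume "A \<in> flat_face ` flat_face_data"
    then obtain F S C where "(F, S, C) \<in> flat_face_data" "A = flat_face (F, S, C)" by auto
    \<comment> \<open>The size is \<open>1 + card S + card C\<close>, at most
      \<open>1 + rank_of M F + (r - rank_of M F - 1) = r\<close>.\<close>
    then show ?thesis
      using card_flat_face[of F S C] flat_face_data_card_bounds[of F S C] by (simp add: r_def)
  qed
  have factor: "(\<Sum>(S, C)\<in>I \<times> T. y * (f S * g C)) = y * (sum f I * sum g T)"
    for I T f g and y :: "int poly"
    unfolding sum_product sum.cartesian_product by (subst sum_distrib_left) (simp only: split_def)
  have face: "w (flat_face (F, S, C)) =
      ?x * ((?x ^ card S * (1 - ?x) ^ (rank_of M F - card S)) *
        (?x ^ card C * (1 - ?x) ^ (r - rank_of M F - 1 - card C)))"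
    if "(F, S, C) \<in> flat_face_data" for F S C
  proof -
    have "r - card (flat_face (F, S, C)) =
        (rank_of M F - card S) + (r - rank_of M F - 1 - card C)"
      using card_flat_face[OF that] flat_face_data_card_bounds[OF that] by (simp add: r_def)
    then show ?thesis
      by (simp only: w_def card_flat_face[OF that] power_add power_Suc mult_ac)
  qed
  have "h_poly (augmented_bergman_complex M) = sum w (augmented_bergman_complex M)"
    unfolding w_def
  proof (rule h_poly_eqI[OF fin bound])
    \<comment> \<open>A basis of \<open>M\<close>, taken with no flats, already attains the size
      \<open>r\<close>.\<close>
    show "Inl ` B \<in> augmented_bergman_complex M"
      using B by (auto simp: augmented_bergman_complex_eq basis_of_def)
    show "card (Inl ` B :: ('a + 'a set) set) = r"
      using rank_of_basis[OF B] card_Inl by (simp add: r_def)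
  qed
  \<comment> \<open>The two families are disjoint: each \<open>flat_face\<close> has an
    \<open>Inr\<close> vertex, the images under \<open>Inl\<close> have none.\<close>
  also have "\<dots> = sum w ((`) Inl ` indep_sets M) + sum w (flat_face ` flat_face_data)"
    unfolding augmented_bergman_complex_eq
    by (rule sum.union_disjoint)
      (use finite_indep_sets finite_flat_face_data in \<open>auto simp: flat_face_def\<close>)
  also have "sum w ((`) Inl ` indep_sets M) = h_poly (independence_complex M)"
    unfolding h_poly_independence
    by (subst sum.reindex) (auto simp: inj_on_def inj_image_eq_iff w_def card_Inl r_def)
  also have "sum w (flat_face ` flat_face_data) = (\<Sum>t\<in>flat_face_data. w (flat_face t))"
    by (simp add: sum.reindex[OF inj_on_flat_face])
  also have "\<dots> = (\<Sum>(F, S, C)\<in>flat_face_data.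
      ?x * ((?x ^ card S * (1 - ?x) ^ (rank_of M F - card S)) *
        (?x ^ card C * (1 - ?x) ^ (r - rank_of M F - 1 - card C))))"
    by (intro sum.cong refl) (auto simp: face simp del: mult_pCons_left)
  also have "\<dots> = (\<Sum>F\<in>flats M - {ground M}. \<Sum>(S, C)\<in>{S. S \<in> indep_sets M \<and> S \<subseteq> F} \<times>
      {C. subset.chain (flats_above F) C}.
      ?x * ((?x ^ card S * (1 - ?x) ^ (rank_of M F - card S)) *
        (?x ^ card C * (1 - ?x) ^ (r - rank_of M F - 1 - card C))))"
    unfolding flat_face_data_def
    by (subst sum.Sigma) (use finite_flats finite_indep_sets finite_chains_flats_above in auto)
  \<comment> \<open>For fixed \<open>F\<close>, \<open>factor\<close> splits the inner sum into the
    sums over \<open>S\<close> and \<open>C\<close>, which are the two h-polynomials.\<close>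
  also have "\<dots> = (\<Sum>F\<in>flats M - {ground M}. ?x *
      (h_poly (independence_complex (restriction M F)) * h_poly (bergman_complex (contraction M F))))"
    by (intro sum.cong refl, subst h_poly_bergman_contraction, assumption)
      (simp only: h_poly_independence_restriction factor r_def)
  finally show ?thesis by (simp only: sum_distrib_left)
qed

end

theorem proposition2p9:
  fixes M :: "'a set_system"
  assumes "matroid M"
  shows "h_poly (augmented_bergman_complex M) =
    h_poly (independence_complex M) +
    [:0, 1:] * (\<Sum>F \<in> flats M - {ground M}.
      h_poly (independence_complex (restriction M F)) * h_poly (bergman_complex (contraction M F)))"
  using assms by (rule matroid.h_poly_augmented_bergman)

end
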